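(* Let $p$ be a prime number and $d\ge 2$ a natural number. Then there exists some $x\in\ell^2(\mathbb Z_p^d)\setminus\{0\}$ such that $$\operatorname{supp}(x)\cap\operatorname{supp}(\hat x)=\emptyset.$$
   Context: $\mathbb Z_p=\{0,1,\ldots,p-1\}$ is the cyclic group of order $p$, $\mathbb Z_p^d$ is the direct product of $d$ copies of it, and $\ell^2(\mathbb Z_p^d)$ is the space of all functions $\mathbb Z_p^d\to\mathbb C$. For $x\in\ell^2(\mathbb Z_p^d)$, the Fourier transform $\hat x\in\ell^2(\mathbb Z_p^d)$ is defined by $$\hat x(t)=\frac{1}{\sqrt{p^d}}\sum_{s\in\mathbb Z_p^d}x(s)\,e^{2\pi i(s_1t_1+\cdots+s_dt_d)/p},\qquad t=(t_1,\ldots,t_d)\in\mathbb Z_p^d,$$ where $s=(s_1,\ldots,s_d)$. The support of a function $f:\mathbb Z_p^d\to\mathbb C$ is $\operatorname{supp}(f)=\{t\in\mathbb Z_p^d: f(t)\neq 0\}$; both supports are regarded as subsets of the same index set $\mathbb Z_p^d$. *)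

theory Defs
  imports
    Complex_Main
    "HOL-Computational_Algebra.Primes"
    "HOL-Algebra.Product_Groups"
begin

text \<open>
  For \<open>p > 0\<close> the group \<open>integer_mod_group p\<close> has carrier \<open>{0..<int p}\<close>, so the elements of
  \<open>\<int>\<^sub>p\<^sup>d\<close> are the tuples \<open>s\<close> with coordinates \<open>s 1, \<dots>, s d \<in> {0..<int p}\<close>.
\<close>

definition Zpd_group :: "nat \<Rightarrow> nat \<Rightarrow> (nat \<Rightarrow> int) monoid"
  where "Zpd_group p d = product_group {1..d} (\<lambda>_. integer_mod_group p)"

abbreviation Zpd :: "nat \<Rightarrow> nat \<Rightarrow> (nat \<Rightarrow> int) set"
  where "Zpd p d \<equiv> carrier (Zpd_group p d)"

text \<open>
  A function on \<open>\<int>\<^sub>p\<^sup>d\<close> is represented by its extension by zero to the whole type, so that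
  distinct elements of \<open>ell2 p d\<close> are distinct functions on \<open>\<int>\<^sub>p\<^sup>d\<close> and the zero vector is
  \<open>\<lambda>_. 0\<close>.
\<close>

definition ell2 :: "nat \<Rightarrow> nat \<Rightarrow> ((nat \<Rightarrow> int) \<Rightarrow> complex) set"
  where "ell2 p d = {x. \<forall>s. s \<notin> Zpd p d \<longrightarrow> x s = 0}"

definition fourier ::
    "nat \<Rightarrow> nat \<Rightarrow> ((nat \<Rightarrow> int) \<Rightarrow> complex) \<Rightarrow> (nat \<Rightarrow> int) \<Rightarrow> complex"
  where "fourier p d x t =
    (if t \<in> Zpd p d
     then complex_of_real (1 / sqrt (real (p ^ d))) *
       (\<Sum>s\<in>Zpd p d. x s *
          exp (2 * complex_of_real pi * \<i> * of_int (\<Sum>k=1..d. s k * t k) / of_nat p))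
     else 0)"

definition supp :: "nat \<Rightarrow> nat \<Rightarrow> ((nat \<Rightarrow> int) \<Rightarrow> complex) \<Rightarrow> (nat \<Rightarrow> int) set"
  where "supp p d f = {t \<in> Zpd p d. f t \<noteq> 0}"

end

theory Submission
  imports Defs "HOL-Analysis.Complex_Transcendental"
begin

text \<open>
  For odd \<open>p\<close> let \<open>L\<close> and \<open>M\<close> be the lines spanned by \<open>e\<^sub>1\<close> and \<open>e\<^sub>1 + e\<^sub>2\<close>, and let \<open>x\<close> be the
  difference of their indicator functions. It is supported on the nonzero points of the two lines,
  while its transform is supported on the union of the hyperplanes \<open>t\<^sub>1 = 0\<close> and \<open>t\<^sub>1 + t\<^sub>2 = 0\<close>,
  which meet both lines only in the origin. For \<open>p = 2\<close> the vector \<open>e\<^sub>1 + e\<^sub>2\<close> is isotropic, and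
  \<open>x = \<delta>\<^sub>0 - \<delta>\<^bsub>e\<^sub>1 + e\<^sub>2\<^esub>\<close> works because its transform vanishes on the hyperplane \<open>t\<^sub>1 + t\<^sub>2 = 0\<close>.
\<close>

lemma Zpd_eq_PiE:
  assumes "p > 0"
  shows "Zpd p d = PiE {1..d} (\<lambda>_. {0..<int p})"
  using assms by (simp add: Zpd_group_def carrier_integer_mod_group)

lemma finite_Zpd:
  assumes "p > 0"
  shows "finite (Zpd p d)"
  using assms by (simp add: Zpd_eq_PiE finite_PiE)

text \<open>The restriction to \<open>{1..d}\<close> makes the point extensional, as membership in
  the \<open>PiE\<close> form of \<open>Zpd\<close> requires.\<close>

definition plane_point :: "nat \<Rightarrow> int \<Rightarrow> int \<Rightarrow> nat \<Rightarrow> int"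
  where "plane_point d a b = (\<lambda>k\<in>{1..d}. if k = 1 then a else if k = 2 then b else 0)"

lemma plane_point_in_Zpd:
  assumes "a \<in> {0..<int p}" and "b \<in> {0..<int p}"
  shows "plane_point d a b \<in> Zpd p d"
  using assms by (subst Zpd_eq_PiE) (auto simp: plane_point_def)

lemma plane_point_coords [simp]:
  assumes "d \<ge> 2"
  shows "plane_point d a b 1 = a" and "plane_point d a b (Suc 0) = a" and "plane_point d a b 2 = b"
  using assms by (simp_all add: plane_point_def)

lemma plane_point_eq_iff:
  assumes "d \<ge> 2"
  shows "plane_point d a b = plane_point d a' b' \<longleftrightarrow> a = a' \<and> b = b'"
  using assms plane_point_coords by metis

lemma plane_point_inner:
  assumes "d \<ge> 2"
  shows "(\<Sum>k=1..d. plane_point d a b k * t k) = a * t 1 + b * t 2"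
proof -
  have "(\<Sum>k=1..d. plane_point d a b k * t k) = (\<Sum>k\<in>{1,2}. plane_point d a b k * t k)"
    using assms by (intro sum.mono_neutral_right) (auto simp: plane_point_def)
  then show ?thesis
    using assms by simp
qed

definition additive_char :: "nat \<Rightarrow> int \<Rightarrow> complex"
  where "additive_char p u = exp (2 * complex_of_real pi * \<i> * of_int u / of_nat p)"

lemma additive_char_eq_1_iff:
  assumes "p > 0"
  shows "additive_char p u = 1 \<longleftrightarrow> int p dvd u"
proof -
  have "additive_char p u = 1 \<longleftrightarrow> (\<exists>n. 2 * pi * real_of_int u / real p = real_of_int (2 * n) * pi)"
    by (simp add: additive_char_def exp_eq_1)
  also have "\<dots> \<longleftrightarrow> (\<exists>n. real_of_int u = real_of_int (int p * n))"
    using assms by (intro ex_cong1) (auto simp: field_simps)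
  also have "\<dots> \<longleftrightarrow> int p dvd u"
    unfolding of_int_eq_iff dvd_def ..
  finally show ?thesis .
qed

lemma additive_char_mult: "additive_char p (int a * u) = additive_char p u ^ a"
  by (simp add: additive_char_def exp_of_nat_mult[symmetric] mult_ac)

text \<open>By \<open>additive_char_mult\<close> this is a geometric sum whose ratio is a
  \<open>p\<close>-th root of unity different from 1.\<close>

lemma sum_additive_char_eq_0:
  assumes "p > 0" and "\<not> int p dvd u"
  shows "(\<Sum>a<p. additive_char p (int a * u)) = 0"
proof -
  have "additive_char p u \<noteq> 1"
    using assms additive_char_eq_1_iff by blast
  moreover have "additive_char p u ^ p = 1"
    using assms additive_char_eq_1_iff[of p "int p * u"] by (simp add: additive_char_mult)
  ultimately show ?thesis
    by (simp add: additive_char_mult sum_gp_strict)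
qed

text \<open>By linearity, each point mass contributes the character attached to its point. The index
  set \<open>I\<close> is left free so that one pair of points and a whole family of pairs are both
  covered.\<close>

lemma fourier_sum_deltas:
  assumes "p > 0" and "t \<in> Zpd p d"
    and "\<And>i. i \<in> I \<Longrightarrow> q i \<in> Zpd p d" and "\<And>i. i \<in> I \<Longrightarrow> r i \<in> Zpd p d"
  shows "fourier p d (\<lambda>s. \<Sum>i\<in>I. of_bool (s = q i) - of_bool (s = r i)) t =
    complex_of_real (1 / sqrt (real (p ^ d))) *
      (\<Sum>i\<in>I. additive_char p (\<Sum>k=1..d. q i k * t k) - additive_char p (\<Sum>k=1..d. r i k * t k))"
proof -
  define e where "e s = additive_char p (\<Sum>k=1..d. s k * t k)" for s
  have delta: "(\<Sum>s\<in>Zpd p d. of_bool (s = y) * e s) = e y" if "y \<in> Zpd p d" for y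
    using that finite_Zpd[OF assms(1)]
    by (simp add: of_bool_def if_distrib[of "\<lambda>c. c * _"] cong: if_cong)
  have "(\<Sum>s\<in>Zpd p d. (\<Sum>i\<in>I. of_bool (s = q i) - of_bool (s = r i)) * e s) =
      (\<Sum>i\<in>I. \<Sum>s\<in>Zpd p d. (of_bool (s = q i) - of_bool (s = r i)) * e s)"
    unfolding sum_distrib_right by (rule sum.swap)
  also have "\<dots> = (\<Sum>i\<in>I. e (q i) - e (r i))"
    using assms(3,4) by (intro sum.cong refl) (simp add: left_diff_distrib sum_subtractf delta)
  finally show ?thesis
    using assms(2) by (simp add: fourier_def e_def additive_char_def)
qed

lemma disjoint_supports_two:
  assumes "d \<ge> 2"
  shows "\<exists>x \<in> ell2 2 d - {\<lambda>_. 0}. supp 2 d x \<inter> supp 2 d (fourier 2 d x) = {}"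
proof -
  define q where "q = plane_point d 0 0"
  define r where "r = plane_point d 1 1"
  define x :: "(nat \<Rightarrow> int) \<Rightarrow> complex"
    \<comment> \<open>The one-element index set gives \<open>x\<close> the shape required by
      \<open>fourier_sum_deltas\<close>.\<close>
    where "x = (\<lambda>s. \<Sum>i\<in>{()}. of_bool (s = q) - of_bool (s = r))"
  have mem: "q \<in> Zpd 2 d" "r \<in> Zpd 2 d"
    unfolding q_def r_def by (rule plane_point_in_Zpd; simp)+
  have "q \<noteq> r"
    using assms by (simp add: q_def r_def plane_point_eq_iff)
  then have "x q \<noteq> 0"
    by (simp add: x_def)
  then have "x \<noteq> (\<lambda>_. 0)"
    by auto
  moreover have "x \<in> ell2 2 d"
    using mem by (auto simp: x_def ell2_def)
  moreover have "fourier 2 d x t = 0" if "x t \<noteq> 0" for t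
  proof -
    from that have t: "t = q \<or> t = r"
      by (auto simp: x_def of_bool_def split: if_splits)
    \<comment> \<open>The coordinate sum is 0 at \<open>q\<close> and 2 at \<open>r\<close>, hence
      even, so the characters of \<open>q\<close> and \<open>r\<close> agree at \<open>t\<close> and
      cancel.\<close>
    have "additive_char 2 (t 1 + t 2) = 1"
      using t assms by (subst additive_char_eq_1_iff) (auto simp: q_def r_def)
    moreover have "additive_char 2 0 = 1"
      by (simp add: additive_char_def)
    moreover have "t \<in> Zpd 2 d"
      using t mem by auto
    ultimately show ?thesis
      using mem assms unfolding x_def
      by (subst fourier_sum_deltas) (simp_all add: q_def r_def plane_point_inner[simplified])
  qed
  ultimately show ?thesis
    by (intro bexI[of _ x]) (auto simp: supp_def)
qed

lemma disjoint_supports_odd: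
  assumes "prime p" and "p > 2" and "d \<ge> 2"
  shows "\<exists>x \<in> ell2 p d - {\<lambda>_. 0}. supp p d x \<inter> supp p d (fourier p d x) = {}"
proof -
  define q where "q a = plane_point d (int a) 0" for a
  define r where "r a = plane_point d (int a) (int a)" for a
  define x :: "(nat \<Rightarrow> int) \<Rightarrow> complex"
    where "x = (\<lambda>s. \<Sum>a<p. of_bool (s = q a) - of_bool (s = r a))"
  have mem: "q a \<in> Zpd p d" "r a \<in> Zpd p d" if "a < p" for a
    unfolding q_def r_def using that by (auto intro!: plane_point_in_Zpd)
  \<comment> \<open>No \<open>r a\<close> equals \<open>q 1\<close>, since its two coordinates
    coincide; only the term of \<open>q\<close> at index 1 survives.\<close>
  have "x (q 1) = (\<Sum>a<p. of_bool (a = 1))"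
    unfolding x_def using assms
    by (intro sum.cong) (auto simp: q_def r_def plane_point_eq_iff)
  also have "\<dots> = 1"
    using assms by (simp add: of_bool_def)
  finally have "x \<noteq> (\<lambda>_. 0)"
    by auto
  moreover have "x \<in> ell2 p d"
    using mem by (auto simp: x_def ell2_def intro!: sum.neutral)
  moreover have "fourier p d x t = 0" if "x t \<noteq> 0" for t
  proof -
    from that obtain a where a: "a < p" "of_bool (t = q a) - of_bool (t = r a) \<noteq> (0::complex)"
      unfolding x_def by (meson lessThan_iff sum.not_neutral_contains_not_neutral)
    then have t: "t = q a \<or> t = r a"
      by (auto split: if_splits)
    \<comment> \<open>At index 0 both lines pass through the origin and the two point masses
      cancel.\<close>
    have "a \<noteq> 0"
      using a(2) by (rule contrapos_nn) (simp add: q_def r_def)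
    then have ndvd: "\<not> int p dvd int a"
      using a(1) by (auto dest: dvd_imp_le)
    \<comment> \<open>Oddness of \<open>p\<close> enters here: for \<open>t = r a\<close> the sum
      \<open>t 1 + t 2\<close> is \<open>2 * int a\<close>.\<close>
    have "\<not> int p dvd 2"
      using assms(2) by (auto dest: zdvd_imp_le)
    then have "\<not> int p dvd 2 * int a"
      using ndvd assms(1) prime_dvd_mult_iff[of "int p" 2 "int a"] by simp
    with ndvd have "\<not> int p dvd t 1" "\<not> int p dvd t 1 + t 2"
      using t assms(3) by (auto simp: q_def r_def)
    \<comment> \<open>The transform at \<open>t\<close> is a multiple of the difference of these two
      character sums, one for each line.\<close>
    then have "(\<Sum>a<p. additive_char p (int a * t 1)) = 0"
      and "(\<Sum>a<p. additive_char p (int a * (t 1 + t 2))) = 0"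
      using assms(2) by (auto intro!: sum_additive_char_eq_0)
    moreover have "t \<in> Zpd p d"
      using t mem a(1) by auto
    ultimately show ?thesis
      using mem assms unfolding x_def
      by (subst fourier_sum_deltas)
        (simp_all add: q_def r_def plane_point_inner[simplified] sum_subtractf distrib_left)
  qed
  ultimately show ?thesis
    by (intro bexI[of _ x]) (auto simp: supp_def)
qed

theorem proposition3:
  fixes p d :: nat
  assumes "prime p" and "d \<ge> 2"
  shows "\<exists>x \<in> ell2 p d - {\<lambda>_. 0}. supp p d x \<inter> supp p d (fourier p d x) = {}"
proof (cases "p = 2")
  case True
  then show ?thesis
    using disjoint_supports_two assms(2) by simp
next
  case False
  then have "p > 2"
    using prime_ge_2_nat[OF assms(1)] by simp
  then show ?thesis
    using disjoint_supports_odd assms by simp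
qed

end
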